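(* Let $J=\begin{pmatrix}0&-1\\1&0\end{pmatrix}$, let $1_2$ and $0_2$ be the $2\times2$ identity and zero matrices, and define real symmetric $10\times10$ matrices $$L_0=\mathrm{diag}\left(\sqrt3,\sqrt3,\tfrac1{\sqrt3},\tfrac1{\sqrt3},0,0,-\tfrac1{\sqrt3},-\tfrac1{\sqrt3},-\sqrt3,-\sqrt3\right),$$ $$L_1=\tfrac1{\sqrt6}\begin{pmatrix}0&0&0&0&3\sqrt2\\0&0&1&0&0\\0&1&0&1&0\\0&0&1&0&0\\3\sqrt2&0&0&0&0\end{pmatrix}\otimes 1_2,\qquad L_2=\tfrac1{\sqrt6}\begin{pmatrix}0_2&0_2&0_2&0_2&-3\sqrt2J\\0_2&0_2&-J&0_2&0_2\\0_2&J&0_2&-J&0_2\\0_2&0_2&J&0_2&0_2\\3\sqrt2J&0_2&0_2&0_2&0_2\end{pmatrix},$$ where $C\otimes 1_2$ denotes the block matrix with $2\times 2$ blocks $c_{ij}1_2$. For $s,t\in\mathbb{R}$ put $L(t,s)=\cos(t)L_0+\sin(t)(\cos(s)L_1+\sin(s)L_2)$. Then: (1) for all $t,s\in\mathbb{R}$ the spectrum of $L(t,s)$ is $\{\sqrt3,\frac1{\sqrt3},0,-\frac1{\sqrt3},-\sqrt3\}$, each eigenvalue having multiplicity $2$; (2) for each fixed $s\in\mathbb{R}$ the space $E_s=\mathrm{span}\{\ker L(t,s): t\in[0,2\pi)\}$ has dimension $4$; (3) $E=\mathrm{span}\{\ker L(t,s): t,s\in\mathbb{R}\}=\mathrm{span}\{e_3,e_4,e_5,e_6,e_7,e_8\}$,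 so $\dim E>4$, where $e_i$ is the $i$-th standard unit vector of $\mathbb{R}^{10}$; (4) the matrices $L(t,s)$ do not all map $E$ into $E^\perp$; in fact $L_0E\not\subset E^\perp$.
   Context: $E^\perp$ is the orthogonal complement with respect to the standard inner product of $\mathbb{R}^{10}$. *)

theory Defs
  imports "HOL-Analysis.Analysis"
begin

text \<open>
  The library function \<^const>\<open>vector\<close> puts the first list entry at index 1. In the numeral type
  of cardinality 10 (resp. 5, 2) the indices are \<open>1, 2, \<dots>, 10\<close> with \<open>10 = 0\<close>, so the \<open>i\<close>-th
  standard unit vector \<open>e\<^sub>i\<close> is \<open>axis i 1\<close>.
\<close>

text \<open>
  Row (or column) \<open>i\<close> of a 10 by 10 matrix lies in block row \<open>block_of i\<close>, at position
  \<open>pos_of i\<close> inside that block row.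
\<close>

definition block_of :: "10 \<Rightarrow> 5" where
  "block_of i = vector [1, 1, 2, 2, 3, 3, 4, 4, 5, 5] $ i"

definition pos_of :: "10 \<Rightarrow> 2" where
  "pos_of i = vector [1, 2, 1, 2, 1, 2, 1, 2, 1, 2] $ i"

definition block_mat :: "real^2^2^5^5 \<Rightarrow> real^10^10" where
  "block_mat B = (\<chi> i j. B $ block_of i $ block_of j $ pos_of i $ pos_of j)"

definition tensor_one2 :: "real^5^5 \<Rightarrow> real^10^10" where
  "tensor_one2 C = block_mat (\<chi> i j. C $ i $ j *\<^sub>R mat 1)"

definition diag_mat :: "real^'n \<Rightarrow> real^'n^'n" where
  "diag_mat d = (\<chi> i j. if i = j then d $ i else 0)"

definition J :: "real^2^2" where
  "J = vector [vector [0, -1], vector [1, 0]]"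

definition L0 :: "real^10^10" where
  "L0 = diag_mat (vector
    [sqrt 3, sqrt 3, 1 / sqrt 3, 1 / sqrt 3, 0, 0, - (1 / sqrt 3), - (1 / sqrt 3), - sqrt 3, - sqrt 3])"

definition L1 :: "real^10^10" where
  "L1 = (1 / sqrt 6) *\<^sub>R tensor_one2 (vector [
    vector [0,          0, 0, 0, 3 * sqrt 2],
    vector [0,          0, 1, 0, 0],
    vector [0,          1, 0, 1, 0],
    vector [0,          0, 1, 0, 0],
    vector [3 * sqrt 2, 0, 0, 0, 0]])"

definition L2 :: "real^10^10" where
  "L2 = (1 / sqrt 6) *\<^sub>R block_mat (vector [
    vector [0,                     0, 0,   0,   - ((3 * sqrt 2) *\<^sub>R J)],
    vector [0,                     0, - J, 0,   0],
    vector [0,                     J, 0,   - J, 0],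
    vector [0,                     0, J,   0,   0],
    vector [(3 * sqrt 2) *\<^sub>R J, 0, 0,   0,   0]])"

definition L :: "real \<Rightarrow> real \<Rightarrow> real^10^10" where
  "L t s = cos t *\<^sub>R L0 + sin t *\<^sub>R (cos s *\<^sub>R L1 + sin s *\<^sub>R L2)"

lemma exhaust_5: "i = 1 \<or> i = 2 \<or> i = 3 \<or> i = 4 \<or> i = 5" for i :: 5
proof (induct i)
  case (of_int z)
  then have "z = 0 \<or> z = 1 \<or> z = 2 \<or> z = 3 \<or> z = 4"
    by simp presburger
  then show ?case by auto
qed

lemma forall_5: "(\<forall>i::5. P i) \<longleftrightarrow> P 1 \<and> P 2 \<and> P 3 \<and> P 4 \<and> P 5"
  by (metis exhaust_5)

lemma transpose_block_mat: "transpose (block_mat B) = block_mat (\<chi> i j. transpose (B $ j $ i))"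
  by (simp add: block_mat_def transpose_def vec_eq_iff)

lemma symmetric_L0: "transpose L0 = L0"
  by (auto simp: L0_def diag_mat_def transpose_def vec_eq_iff)

lemma symmetric_L1: "transpose L1 = L1"
  unfolding L1_def tensor_one2_def transpose_scalar transpose_block_mat
  by (rule arg_cong[where f = "\<lambda>B. (1 / sqrt 6) *\<^sub>R block_mat B"])
     (simp add: vec_eq_iff transpose_def mat_def forall_5 forall_2 vector_def)

lemma symmetric_L2: "transpose L2 = L2"
  unfolding L2_def transpose_scalar transpose_block_mat
  by (rule arg_cong[where f = "\<lambda>B. (1 / sqrt 6) *\<^sub>R block_mat B"])
     (simp add: vec_eq_iff transpose_def J_def forall_5 forall_2 vector_def)

lemma symmetric_L: "transpose (L t s) = L t s"
proof -
  have "L0 $ j $ i = L0 $ i $ j" "L1 $ j $ i = L1 $ i $ j" "L2 $ j $ i = L2 $ i $ j" for i j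
    using symmetric_L0 symmetric_L1 symmetric_L2 by (simp_all add: transpose_def vec_eq_iff)
  then show ?thesis
    by (simp add: L_def transpose_def vec_eq_iff)
qed

definition kernel :: "real^'n^'m \<Rightarrow> (real^'n) set" where
  "kernel A = {x. A *v x = 0}"

definition eigenspace :: "real^'n^'n \<Rightarrow> real \<Rightarrow> (real^'n) set" where
  "eigenspace A c = {x. A *v x = c *\<^sub>R x}"

text \<open>
  The two notions below are the usual ones for real symmetric matrices: all complex eigenvalues are
  real, and the algebraic and geometric multiplicities coincide.
\<close>

definition spectrum :: "real^'n^'n \<Rightarrow> real set" where
  "spectrum A = {c. \<exists>x. x \<noteq> 0 \<and> A *v x = c *\<^sub>R x}"

definition eigen_multiplicity :: "real^'n^'n \<Rightarrow> real \<Rightarrow> nat" where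
  "eigen_multiplicity A c = dim (eigenspace A c)"

definition Es :: "real \<Rightarrow> (real^10) set" where
  "Es s = span (\<Union>t\<in>{0..<2 * pi}. kernel (L t s))"

definition E :: "(real^10) set" where
  "E = span (\<Union>t. \<Union>s. kernel (L t s))"

end

theory Submission
  imports Defs
begin

text \<open>
  Identify \<open>\<real>\<^sup>1\<^sup>0\<close> with \<open>\<complex>\<^sup>5\<close>, one complex coordinate per block, so that \<open>J\<close> is multiplication by the
  imaginary unit. Then \<open>s\<close> enters \<open>L t s\<close> only through the phases \<open>cis (\<plusminus> s)\<close>, and \<open>L t s\<close> decouples
  into \<open>sqrt 3\<close> times a reflection at half angle \<open>t / 2\<close> on coordinates 1 and 5, and \<open>1 / sqrt 3\<close> times
  a spin-1 matrix with eigenvalues \<open>1, 0, -1\<close> on coordinates 2, 3 and 4. Each of the five values thus has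
  an explicit plane of eigenvectors, and orthogonality of eigenspaces leaves no room for more. The
  kernel is spanned over the complex numbers by
  \<open>(0, sin t / sqrt 2 * cis (- s), - cos t, - sin t / sqrt 2 * cis s, 0)\<close>: for fixed \<open>s\<close> these vectors
  have complex span of dimension 2, but varying \<open>s\<close> separates coordinates 2 and 4.
\<close>

section \<open>Indices of the ten-element type\<close>

lemma exhaust_10:
  "i = 1 \<or> i = 2 \<or> i = 3 \<or> i = 4 \<or> i = 5 \<or> i = 6 \<or> i = 7 \<or> i = 8 \<or> i = 9 \<or> i = 10" for i :: 10
proof (induct i)
  case (of_int z)
  then have "z = 0 \<or> z = 1 \<or> z = 2 \<or> z = 3 \<or> z = 4 \<or> z = 5 \<or> z = 6 \<or> z = 7 \<or> z = 8 \<or> z = 9"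
    by simp presburger
  then show ?case by auto
qed

lemma UNIV_10: "(UNIV :: 10 set) = {1, 2, 3, 4, 5, 6, 7, 8, 9, 10}"
  using exhaust_10 by auto

lemma forall_10:
  "(\<forall>i::10. P i) \<longleftrightarrow> P 1 \<and> P 2 \<and> P 3 \<and> P 4 \<and> P 5 \<and> P 6 \<and> P 7 \<and> P 8 \<and> P 9 \<and> P 10"
  by (metis exhaust_10)

lemma sum_10: "sum f (UNIV :: 10 set) = f 1 + f 2 + f 3 + f 4 + f 5 + f 6 + f 7 + f 8 + f 9 + f 10"
  unfolding UNIV_10 by (simp add: ac_simps)

text \<open>The last index has the two spellings \<open>10\<close> and \<open>0\<close>, which
  denote the same element; each gets its own rule.\<close>

lemma block_of_simps [simp]:
  "block_of 1 = 1" "block_of 2 = 1" "block_of 3 = 2" "block_of 4 = 2" "block_of 5 = 3"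
  "block_of 6 = 3" "block_of 7 = 4" "block_of 8 = 4" "block_of 9 = 5" "block_of 10 = 5" "block_of 0 = 5"
  by (simp_all add: block_of_def vector_def)

lemma pos_of_simps [simp]:
  "pos_of 1 = 1" "pos_of 2 = 2" "pos_of 3 = 1" "pos_of 4 = 2" "pos_of 5 = 1"
  "pos_of 6 = 2" "pos_of 7 = 1" "pos_of 8 = 2" "pos_of 9 = 1" "pos_of 10 = 2" "pos_of 0 = 2"
  by (simp_all add: pos_of_def vector_def)

section \<open>Complex coordinates and the action of the matrices\<close>

definition cvec :: "complex \<Rightarrow> complex \<Rightarrow> complex \<Rightarrow> complex \<Rightarrow> complex \<Rightarrow> real^10" where
  "cvec a b c d e = vector [Re a, Im a, Re b, Im b, Re c, Im c, Re d, Im d, Re e, Im e]"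

lemma vector_10 [simp]:
  fixes a b c d e f g h i j :: "'a::zero"
  defines "v \<equiv> vector [a, b, c, d, e, f, g, h, i, j] :: 'a^10"
  shows "v $ 1 = a" "v $ 2 = b" "v $ 3 = c" "v $ 4 = d" "v $ 5 = e"
    "v $ 6 = f" "v $ 7 = g" "v $ 8 = h" "v $ 9 = i" "v $ 10 = j" "v $ 0 = j"
  by (simp_all add: v_def vector_def)

lemma vector_5 [simp]:
  fixes a b c d e :: "'a::zero"
  defines "v \<equiv> vector [a, b, c, d, e] :: 'a^5"
  shows "v $ 1 = a" "v $ 2 = b" "v $ 3 = c" "v $ 4 = d" "v $ 5 = e" "v $ 0 = e"
  by (simp_all add: v_def vector_def)

lemma cvec_eq_iff:
  "cvec a b c d e = cvec a' b' c' d' e' \<longleftrightarrow> a = a' \<and> b = b' \<and> c = c' \<and> d = d' \<and> e = e'"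
  by (auto simp: cvec_def vec_eq_iff forall_10 complex_eq_iff)

lemma cvec_add: "cvec a b c d e + cvec a' b' c' d' e' = cvec (a + a') (b + b') (c + c') (d + d') (e + e')"
  by (auto simp: cvec_def vec_eq_iff forall_10)

lemma cvec_scaleR: "r *\<^sub>R cvec a b c d e = cvec (r *\<^sub>R a) (r *\<^sub>R b) (r *\<^sub>R c) (r *\<^sub>R d) (r *\<^sub>R e)"
  by (auto simp: cvec_def vec_eq_iff forall_10)

lemma L0_mult_cvec:
  "L0 *v cvec a b c d e = cvec (sqrt 3 *\<^sub>R a) ((1 / sqrt 3) *\<^sub>R b) 0 (- (1 / sqrt 3) *\<^sub>R d) (- sqrt 3 *\<^sub>R e)"
  unfolding L0_def diag_mat_def matrix_vector_mult_def cvec_def vec_eq_iff forall_10 sum_10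
  by simp

lemma L1_mult_cvec:
  "L1 *v cvec a b c d e =
     (1 / sqrt 6) *\<^sub>R cvec ((3 * sqrt 2) *\<^sub>R e) c (b + d) c ((3 * sqrt 2) *\<^sub>R a)"
  unfolding L1_def tensor_one2_def block_mat_def scaleR_matrix_vector_assoc[symmetric]
  by (rule arg_cong[where f = "\<lambda>x. (1 / sqrt 6) *\<^sub>R x"])
    (simp add: matrix_vector_mult_def cvec_def vec_eq_iff forall_10 sum_10 mat_def)

lemma L2_mult_cvec:
  "L2 *v cvec a b c d e =
     (1 / sqrt 6) *\<^sub>R cvec (- (3 * sqrt 2) *\<^sub>R (\<i> * e)) (- \<i> * c) (\<i> * b - \<i> * d) (\<i> * c)
       ((3 * sqrt 2) *\<^sub>R (\<i> * a))"
  unfolding L2_def block_mat_def scaleR_matrix_vector_assoc[symmetric]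
  by (rule arg_cong[where f = "\<lambda>x. (1 / sqrt 6) *\<^sub>R x"])
    (simp add: matrix_vector_mult_def cvec_def vec_eq_iff forall_10 sum_10 J_def)

text \<open>The real coefficients of \<open>L1\<close> and the imaginary ones of \<open>L2\<close>
  combine as \<open>cos s\<close> plus or minus \<open>\<i> * sin s\<close>, that is, into
  \<open>cis s\<close> and \<open>cis (- s)\<close>.\<close>

lemma L_mult_cvec:
  "L t s *v cvec a b c d e = cvec
     (sqrt 3 *\<^sub>R (cos t *\<^sub>R a + sin t *\<^sub>R (cis (- s) * e)))
     ((1 / sqrt 3) *\<^sub>R (cos t *\<^sub>R b + (sin t / sqrt 2) *\<^sub>R (cis (- s) * c)))
     ((1 / sqrt 3) *\<^sub>R (sin t / sqrt 2) *\<^sub>R (cis s * b + cis (- s) * d))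
     ((1 / sqrt 3) *\<^sub>R ((sin t / sqrt 2) *\<^sub>R (cis s * c) - cos t *\<^sub>R d))
     (sqrt 3 *\<^sub>R (sin t *\<^sub>R (cis s * a) - cos t *\<^sub>R e))"
proof -
  \<comment> \<open>Splitting \<open>1 / sqrt 6\<close> as \<open>p * q\<close> reduces the corner
    entries to \<open>sqrt 3\<close> and leaves the factor \<open>1 / sqrt 3\<close> in front of the
    inner block.\<close>
  define p q where "p = 1 / sqrt 3" and "q = 1 / sqrt 2"
  have pq: "sin t / sqrt 2 = sin t * q" "1 / sqrt 6 = p * q"
    by (simp_all add: p_def q_def flip: real_sqrt_mult)
  have "p * q * (3 * sqrt 2) = 3 * p"
    by (simp add: q_def)
  also have "\<dots> = sqrt 3"
    by (simp add: p_def real_div_sqrt)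
  finally have outer: "p * q * (3 * sqrt 2) = sqrt 3" .
  have L1: "L1 *v cvec a b c d e =
      cvec (sqrt 3 *\<^sub>R e) ((p * q) *\<^sub>R c) ((p * q) *\<^sub>R (b + d)) ((p * q) *\<^sub>R c) (sqrt 3 *\<^sub>R a)"
    by (simp only: L1_mult_cvec pq cvec_scaleR scaleR_scaleR outer)
  have L2: "L2 *v cvec a b c d e =
      cvec (- sqrt 3 *\<^sub>R (\<i> * e)) ((p * q) *\<^sub>R (- \<i> * c)) ((p * q) *\<^sub>R (\<i> * b - \<i> * d))
        ((p * q) *\<^sub>R (\<i> * c)) (sqrt 3 *\<^sub>R (\<i> * a))"
    by (simp only: L2_mult_cvec pq cvec_scaleR scaleR_scaleR outer mult_minus_right)
  show ?thesis
    unfolding L_def matrix_vector_mult_add_rdistrib scaleR_matrix_vector_assoc[symmetric]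
      L0_mult_cvec L1 L2 cvec_add cvec_scaleR cvec_eq_iff pq p_def[symmetric]
    by (simp add: complex_eq_iff algebra_simps)
qed

section \<open>Multiplicities of symmetric matrices\<close>

lemma eigenspace_orthogonal:
  fixes A :: "real^'n^'n"
  assumes "transpose A = A" "x \<in> eigenspace A c" "y \<in> eigenspace A d" "c \<noteq> d"
  shows "x \<bullet> y = 0"
proof -
  have "c * (x \<bullet> y) = (A *v x) \<bullet> y"
    using assms(2) by (simp add: eigenspace_def)
  also have "\<dots> = x \<bullet> (A *v y)"
    by (simp only: transpose_matrix_vector[of A x, unfolded assms(1)] dot_lmul_matrix)
  also have "\<dots> = d * (x \<bullet> y)"
    using assms(3) by (simp add: eigenspace_def)
  finally show ?thesis
    using assms(4) by simp
qed

text \<open>Each new eigenspace is orthogonal to all earlier ones, so dimensions add. The union need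
  not be a subspace; \<open>dim\<close> measures its span.\<close>

lemma dim_Union_eigenspaces:
  fixes A :: "real^'n^'n"
  assumes "transpose A = A" "finite S"
  shows "dim (\<Union>c\<in>S. eigenspace A c) = (\<Sum>c\<in>S. eigen_multiplicity A c)"
  using assms(2)
proof (induction S)
  case (insert c S)
  have "dim (eigenspace A c \<union> (\<Union>c\<in>S. eigenspace A c)) =
      dim (eigenspace A c) + dim (\<Union>c\<in>S. eigenspace A c)"
    using insert.hyps by (intro dim_orthogonal_sum) (auto intro: eigenspace_orthogonal[OF assms(1)])
  then show ?case
    using insert by (simp add: eigen_multiplicity_def)
qed simp

lemma sum_eigen_multiplicity_le:
  fixes A :: "real^'n^'n"
  assumes "transpose A = A" "finite S"
  shows "(\<Sum>c\<in>S. eigen_multiplicity A c) \<le> CARD('n)"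
  using dim_subset_UNIV[of "\<Union>c\<in>S. eigenspace A c"] by (simp add: dim_Union_eigenspaces[OF assms])

lemma subspace_eigenspace: "subspace (eigenspace A c)"
  by (auto simp: subspace_def eigenspace_def matrix_vector_right_distrib scaleR_right_distrib
      matrix_vector_mult_scaleR)

lemma spectrum_iff: "c \<in> spectrum A \<longleftrightarrow> 0 < eigen_multiplicity A c"
proof -
  have "eigen_multiplicity A c = 0 \<longleftrightarrow> eigenspace A c \<subseteq> {0}"
    by (simp add: eigen_multiplicity_def)
  then show ?thesis
    by (auto simp: spectrum_def eigenspace_def)
qed

text \<open>A counting argument: the lower bounds \<open>m\<close> already exhaust the whole
  dimension, so no multiplicity can exceed \<open>m\<close> and no further eigenvalue has room.
  Explicit eigenvectors thus suffice, without a characteristic polynomial.\<close>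

lemma spectrum_eqI:
  fixes A :: "real^'n^'n"
  assumes sym: "transpose A = A" and fin: "finite S" and pos: "0 < m"
    and card: "card S * m = CARD('n)"
    and mult: "\<And>c. c \<in> S \<Longrightarrow> m \<le> eigen_multiplicity A c"
  shows "spectrum A = S \<and> (\<forall>c\<in>spectrum A. eigen_multiplicity A c = m)"
proof -
  have ge: "card S * m \<le> (\<Sum>c\<in>S. eigen_multiplicity A c)"
    using sum_mono[of S "\<lambda>_. m", OF mult] by simp
  have eq: "eigen_multiplicity A c = m" if "c \<in> S" for c
  proof (rule ccontr)
    assume "eigen_multiplicity A c \<noteq> m"
    then have "m < eigen_multiplicity A c"
      using mult[OF that] by simp
    then have "(\<Sum>c\<in>S. m) < (\<Sum>c\<in>S. eigen_multiplicity A c)"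
      using mult that by (intro sum_strict_mono_ex1 fin) auto
    then show False
      using sum_eigen_multiplicity_le[OF sym fin] card by simp
  qed
  have "c \<in> S" if "c \<in> spectrum A" for c
  proof (rule ccontr)
    assume "c \<notin> S"
    then show False
      using sum_eigen_multiplicity_le[OF sym, of "insert c S"] fin ge card that
      by (simp add: spectrum_iff)
  qed
  moreover have "c \<in> spectrum A" if "c \<in> S" for c
    using eq[OF that] pos by (simp add: spectrum_iff)
  ultimately have "spectrum A = S"
    by blast
  then show ?thesis
    using eq by simp
qed

section \<open>Explicit planes of eigenvectors\<close>

lemma dim_range_inj_linear:
  fixes f :: "'a::euclidean_space \<Rightarrow> 'b::euclidean_space"
  assumes "linear f" "inj f"
  shows "dim (range f) = DIM('a)"
  using dim_image_eq[OF assms(1), of UNIV] assms(2) by simp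

lemma eigen_multiplicity_geI:
  fixes f :: "'a::euclidean_space \<Rightarrow> real^'n"
  assumes "linear f" "inj f" "\<And>w. A *v f w = c *\<^sub>R f w"
  shows "DIM('a) \<le> eigen_multiplicity A c"
  unfolding eigen_multiplicity_def dim_range_inj_linear[OF assms(1,2), symmetric]
  by (rule dim_subset) (auto simp: eigenspace_def assms(3))

text \<open>Up to the phase \<open>cis s\<close> on coordinate 5, this is the direction at angle
  \<open>t / 2\<close>, the axis of the reflection.\<close>

definition outer_block_vec :: "real \<Rightarrow> real \<Rightarrow> complex \<Rightarrow> real^10" where
  "outer_block_vec t s w = cvec (cos (t / 2) *\<^sub>R w) 0 0 0 (sin (t / 2) *\<^sub>R (cis s * w))"

text \<open>Up to the phase \<open>cis (- s)\<close>, the symmetric square of the outer vector: the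
  coefficients are the squares of \<open>cos (t / 2)\<close> and \<open>sin (t / 2)\<close>, and
  \<open>sqrt 2\<close> times their product.\<close>

definition inner_block_vec :: "real \<Rightarrow> real \<Rightarrow> complex \<Rightarrow> real^10" where
  "inner_block_vec t s w = cvec 0 (((1 + cos t) / 2) *\<^sub>R (cis (- s) * w)) ((sin t / sqrt 2) *\<^sub>R w)
     (((1 - cos t) / 2) *\<^sub>R (cis s * w)) 0"

definition kernel_vec :: "real \<Rightarrow> real \<Rightarrow> complex \<Rightarrow> real^10" where
  "kernel_vec t s w = cvec 0 ((sin t / sqrt 2) *\<^sub>R (cis (- s) * w)) (- cos t *\<^sub>R w)
     (- (sin t / sqrt 2) *\<^sub>R (cis s * w)) 0"

lemma linear_outer_block_vec: "linear (outer_block_vec t s)"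
  unfolding outer_block_vec_def by (intro linearI) (simp_all add: cvec_add cvec_scaleR algebra_simps)

lemma linear_inner_block_vec: "linear (inner_block_vec t s)"
  unfolding inner_block_vec_def by (intro linearI) (simp_all add: cvec_add cvec_scaleR algebra_simps)

lemma linear_kernel_vec: "linear (kernel_vec t s)"
  unfolding kernel_vec_def by (intro linearI) (simp_all add: cvec_add cvec_scaleR algebra_simps)

lemma inj_outer_block_vec: "inj (outer_block_vec t s)"
proof (rule injI)
  fix w w' assume "outer_block_vec t s w = outer_block_vec t s w'"
  then show "w = w'"
    \<comment> \<open>Cosine and sine have no common zero, so one of the two coordinates determines
      \<open>w\<close>.\<close>
    using sin_zero_abs_cos_one[of "t / 2"] by (auto simp: outer_block_vec_def cvec_eq_iff)
qed

text \<open>The coefficients of coordinates 2 and 4 sum to 1, so they do not both vanish.\<close>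

lemma inj_inner_block_vec: "inj (inner_block_vec t s)"
  by (auto simp: inj_def inner_block_vec_def cvec_eq_iff)

lemma inj_kernel_vec: "inj (kernel_vec t s)"
proof (rule injI)
  fix w w' assume "kernel_vec t s w = kernel_vec t s w'"
  then show "w = w'"
    using sin_zero_abs_cos_one[of t] by (auto simp: kernel_vec_def cvec_eq_iff)
qed

lemma cis_mult_cancel: "cis s * (cis (- s) * z) = z" "cis (- s) * (cis s * z) = z"
  by (simp_all add: cis_mult flip: mult.assoc)

lemma L_mult_outer_block_vec: "L t s *v outer_block_vec t s w = sqrt 3 *\<^sub>R outer_block_vec t s w"
proof -
  define c r where "c = cos (t / 2)" and "r = sin (t / 2)"
  have t: "cos t = c\<^sup>2 - r\<^sup>2" "sin t = 2 * r * c" and one: "r\<^sup>2 = 1 - c\<^sup>2"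
    using cos_double[of "t / 2"] sin_double[of "t / 2"] sin_squared_eq[of "t / 2"]
    by (simp_all only: c_def r_def) simp_all
  \<comment> \<open>The subtraction formulas for cosine and sine at
    \<open>t - t / 2\<close>.\<close>
  have "cos t * c + sin t * r = c" "sin t * c - cos t * r = r"
    unfolding t using one by algebra+
  then show ?thesis
    unfolding outer_block_vec_def L_mult_cvec cvec_scaleR cvec_eq_iff c_def[symmetric] r_def[symmetric]
    by (simp add: cis_mult_cancel flip: scaleR_left_distrib scaleR_left_diff_distrib)
qed

lemma L_mult_inner_block_vec: "L t s *v inner_block_vec t s w = (1 / sqrt 3) *\<^sub>R inner_block_vec t s w"
proof -
  define c k p m where "c = cos t" and "k = sin t / sqrt 2"
    and "p = (1 + cos t) / 2" and "m = (1 - cos t) / 2"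
  have "2 * (k * k) = 1 - c * c"
    using sin_squared_eq[of t] by (simp add: c_def k_def power2_eq_square)
  \<comment> \<open>One identity for each of the coordinates 2, 3 and 4.\<close>
  then have "c * p + k * k = p" "p + m = 1" "k * k - c * m = m"
    by (simp_all add: c_def p_def m_def field_simps)
  then show ?thesis
    unfolding inner_block_vec_def L_mult_cvec cvec_scaleR cvec_eq_iff
      p_def[symmetric] m_def[symmetric]
    \<comment> \<open>\<open>p\<close> and \<open>m\<close> contain \<open>cos t\<close>, so they
      are folded before \<open>cos t\<close> becomes \<open>c\<close>.\<close>
    unfolding c_def[symmetric] k_def[symmetric]
    by (simp add: cis_mult_cancel flip: scaleR_left_distrib scaleR_left_diff_distrib)
qed

lemma L_mult_kernel_vec: "L t s *v kernel_vec t s w = 0"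
proof -
  have 0: "cvec 0 0 0 0 0 = 0"
    by (simp add: cvec_def vec_eq_iff forall_10)
  show ?thesis
    unfolding kernel_vec_def L_mult_cvec 0[symmetric] cvec_eq_iff
    by (simp add: cis_mult_cancel)
qed

text \<open>The negative eigenvalues at \<open>t\<close> come from the positive ones at \<open>t + pi\<close>.\<close>

lemma L_mult_eq_minus: "L t s *v x = - (L (t + pi) s *v x)"
proof -
  have "L t s = - L (t + pi) s"
    by (simp add: L_def algebra_simps)
  then show ?thesis
    by (simp add: matrix_vector_mult_def vec_eq_iff sum_negf)
qed

lemma eigen_multiplicity_L_ge:
  assumes "c \<in> {sqrt 3, 1 / sqrt 3, 0, - (1 / sqrt 3), - sqrt 3}"
  shows "2 \<le> eigen_multiplicity (L t s) c"
proof -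
  have neg: "L t s *v outer_block_vec (t + pi) s w = (- sqrt 3) *\<^sub>R outer_block_vec (t + pi) s w"
    "L t s *v inner_block_vec (t + pi) s w = (- (1 / sqrt 3)) *\<^sub>R inner_block_vec (t + pi) s w" for w
    by (simp_all only: L_mult_eq_minus[of t s] L_mult_outer_block_vec L_mult_inner_block_vec scaleR_minus_left)
  have zero: "L t s *v kernel_vec t s w = 0 *\<^sub>R kernel_vec t s w" for w
    by (simp add: L_mult_kernel_vec)
  note ge = eigen_multiplicity_geI[OF linear_outer_block_vec inj_outer_block_vec L_mult_outer_block_vec]
    eigen_multiplicity_geI[OF linear_inner_block_vec inj_inner_block_vec L_mult_inner_block_vec]
    eigen_multiplicity_geI[OF linear_outer_block_vec inj_outer_block_vec neg(1)]
    eigen_multiplicity_geI[OF linear_inner_block_vec inj_inner_block_vec neg(2)]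
    eigen_multiplicity_geI[OF linear_kernel_vec inj_kernel_vec zero]
  from assms consider "c = sqrt 3" | "c = 1 / sqrt 3" | "c = 0" | "c = - (1 / sqrt 3)" | "c = - sqrt 3"
    by blast
  then show ?thesis
    by cases (simp_all only: ge[unfolded DIM_complex])
qed

section \<open>The spectrum and the kernel of \<open>L t s\<close>\<close>

lemma spectrum_L:
  "spectrum (L t s) = {sqrt 3, 1 / sqrt 3, 0, - (1 / sqrt 3), - sqrt 3} \<and>
    (\<forall>c\<in>spectrum (L t s). eigen_multiplicity (L t s) c = 2)"
proof (rule spectrum_eqI[OF symmetric_L])
  \<comment> \<open>The count \<open>5 * 2 = 10\<close> requires the five values to be
    different.\<close>
  have "distinct [p, q, 0, - q, - p]" if "0 < q" "q < p" for p q :: real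
    using that by auto
  from this[of "1 / sqrt 3" "sqrt 3"]
  have "distinct [sqrt 3, 1 / sqrt 3, 0, - (1 / sqrt 3), - sqrt 3]"
    by (simp add: field_simps)
  then show "card {sqrt 3, 1 / sqrt 3, 0, - (1 / sqrt 3), - sqrt 3} * 2 = CARD(10)"
    using distinct_card by fastforce
qed (auto intro: eigen_multiplicity_L_ge[simplified])

text \<open>The explicit plane lies in the kernel, and the multiplicity of 0 is exactly 2, so the
  two coincide.\<close>

lemma kernel_L: "kernel (L t s) = range (kernel_vec t s)"
proof (rule subspace_dim_equal[symmetric])
  have ker: "kernel (L t s) = eigenspace (L t s) 0"
    by (simp add: kernel_def eigenspace_def)
  show "subspace (range (kernel_vec t s))"
    by (simp add: linear_kernel_vec linear_subspace_image)
  show "subspace (kernel (L t s))"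
    by (simp add: ker subspace_eigenspace)
  show "range (kernel_vec t s) \<subseteq> kernel (L t s)"
    by (auto simp: kernel_def L_mult_kernel_vec)
  show "dim (range (kernel_vec t s)) \<ge> dim (kernel (L t s))"
    using spectrum_L[of t s]
    by (simp add: ker dim_range_inj_linear[OF linear_kernel_vec inj_kernel_vec] eigen_multiplicity_def)
qed

section \<open>The spans of the kernels\<close>

lemma Es_eq: "Es s = range (\<lambda>(p, q). cvec 0 (cis (- s) * p) q (- cis s * p) 0)"
  (is "_ = range ?f")
proof
  have lin: "linear ?f"
    by (intro linearI) (auto simp: cvec_add cvec_scaleR algebra_simps)
  have kv: "kernel_vec t s w = ?f ((sin t / sqrt 2) *\<^sub>R w, - cos t *\<^sub>R w)" for t w
    by (simp add: kernel_vec_def cvec_eq_iff)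
  have "kernel (L t s) \<subseteq> range ?f" for t
    unfolding kernel_L by (rule image_subsetI, subst kv, rule rangeI)
  then show "Es s \<subseteq> range ?f"
    unfolding Es_def by (intro span_minimal linear_subspace_image[OF lin]) auto
  show "range ?f \<subseteq> Es s"
  proof clarify
    fix p q
    have mem: "kernel_vec t s w \<in> Es s" if "t \<in> {0..<2 * pi}" for t w
      unfolding Es_def kernel_L using that by (intro span_base UN_I[of t] rangeI)
    \<comment> \<open>Two angles suffice: \<open>t = pi / 2\<close> isolates the \<open>p\<close>
      part, where \<open>sqrt 2\<close> cancels the denominator, and \<open>t = 0\<close> isolates
      the \<open>q\<close> part.\<close>
    have "kernel_vec (pi / 2) s (sqrt 2 *\<^sub>R p) \<in> Es s" "kernel_vec 0 s (- q) \<in> Es s"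
      by (intro mem; simp)+
    then have "kernel_vec (pi / 2) s (sqrt 2 *\<^sub>R p) + kernel_vec 0 s (- q) \<in> Es s"
      unfolding Es_def by (rule span_add)
    then show "cvec 0 (cis (- s) * p) q (- cis s * p) 0 \<in> Es s"
      by (simp add: kernel_vec_def cvec_add)
  qed
qed

lemma dim_Es: "dim (Es s) = 4"
proof -
  let ?f = "\<lambda>(p, q). cvec 0 (cis (- s) * p) q (- cis s * p) 0"
  have "linear ?f"
    by (intro linearI) (auto simp: cvec_add cvec_scaleR algebra_simps)
  moreover have "inj ?f"
    by (auto simp: inj_def cvec_eq_iff)
  ultimately show ?thesis
    unfolding Es_eq by (subst dim_range_inj_linear) auto
qed

definition mid_vec :: "complex \<times> complex \<times> complex \<Rightarrow> real^10" where
  "mid_vec = (\<lambda>(b, c, d). cvec 0 b c d 0)"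

lemma linear_mid_vec: "linear mid_vec"
  by (intro linearI) (auto simp: mid_vec_def cvec_add cvec_scaleR)

lemma inj_mid_vec: "inj mid_vec"
  by (auto simp: inj_def mid_vec_def cvec_eq_iff)

text \<open>Two values of \<open>s\<close> suffice: \<open>s = 0\<close> supplies opposite entries
  in coordinates 2 and 4, and \<open>s = pi / 2\<close> supplies equal ones.\<close>

lemma E_eq: "E = range mid_vec"
proof
  have "kernel (L t s) \<subseteq> range mid_vec" for t s
    by (auto simp: kernel_L kernel_vec_def mid_vec_def image_iff cvec_eq_iff)
  then show "E \<subseteq> range mid_vec"
    unfolding E_def by (intro span_minimal linear_subspace_image[OF linear_mid_vec]) auto
  show "range mid_vec \<subseteq> E"
  proof clarify
    fix b c d
    have Es: "Es s \<subseteq> E" for s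
      unfolding Es_def E_def by (intro span_mono) auto
    have "cvec 0 p q (- p) 0 \<in> E" for p q
      using Es[of 0] unfolding Es_eq by (force simp: image_iff)
    moreover have "cvec 0 (- \<i> * p) 0 (- \<i> * p) 0 \<in> E" for p
      using Es[of "pi / 2"] unfolding Es_eq by (force simp: image_iff cis_pi_half)
    \<comment> \<open>The pair \<open>(b, d)\<close> is split into its antisymmetric and symmetric
      halves; the factor \<open>\<i>\<close> cancels the \<open>- \<i>\<close> coming from
      \<open>s = pi / 2\<close>.\<close>
    ultimately have "cvec 0 ((b - d) / 2) c (- ((b - d) / 2)) 0 +
        cvec 0 (- \<i> * (\<i> * ((b + d) / 2))) 0 (- \<i> * (\<i> * ((b + d) / 2))) 0 \<in> E"
      unfolding E_def by (intro span_add)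
    then show "mid_vec (b, c, d) \<in> E"
      by (simp add: mid_vec_def cvec_add field_simps)
  qed
qed

lemma E_eq_span_axis: "E = span {axis 3 1, axis 4 1, axis 5 1, axis 6 1, axis 7 1, axis 8 1}"
  (is "_ = span ?A")
proof
  have "?A \<subseteq> E"
  proof -
    have "axis 3 1 = mid_vec (1, 0, 0)" "axis 4 1 = mid_vec (\<i>, 0, 0)" "axis 5 1 = mid_vec (0, 1, 0)"
      "axis 6 1 = mid_vec (0, \<i>, 0)" "axis 7 1 = mid_vec (0, 0, 1)" "axis 8 1 = mid_vec (0, 0, \<i>)"
      by (simp_all add: mid_vec_def cvec_def vec_eq_iff forall_10 axis_def)
    then show ?thesis
      unfolding E_eq by auto
  qed
  then show "span ?A \<subseteq> E"
    by (intro span_minimal) (simp_all add: E_def)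
  show "E \<subseteq> span ?A"
    unfolding E_eq
  proof clarify
    fix b c d
    have "mid_vec (b, c, d) = Re b *\<^sub>R axis 3 1 + Im b *\<^sub>R axis 4 1 + Re c *\<^sub>R axis 5 1 +
        Im c *\<^sub>R axis 6 1 + Re d *\<^sub>R axis 7 1 + Im d *\<^sub>R axis 8 1"
      by (simp add: mid_vec_def cvec_def vec_eq_iff forall_10 axis_def)
    also have "\<dots> \<in> span ?A"
      by (intro span_add span_scale span_base) auto
    finally show "mid_vec (b, c, d) \<in> span ?A" .
  qed
qed

lemma dim_E: "dim E = 6"
  unfolding E_eq dim_range_inj_linear[OF linear_mid_vec inj_mid_vec] by simp

section \<open>Failure of the orthogonality property\<close>

lemma L0_image_E: "\<not> (*v) L0 ` E \<subseteq> orthogonal_comp E"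
proof
  \<comment> \<open>This is the third unit vector, an eigenvector of \<open>L0\<close> for
    \<open>1 / sqrt 3\<close>; its image is a nonzero multiple of itself and so not orthogonal to
    it.\<close>
  let ?x = "cvec 0 1 0 0 0"
  assume sub: "(*v) L0 ` E \<subseteq> orthogonal_comp E"
  have "?x \<in> E"
    unfolding E_eq mid_vec_def by (force simp: image_iff)
  moreover from this sub have "L0 *v ?x \<in> orthogonal_comp E"
    by blast
  ultimately have "?x \<bullet> (L0 *v ?x) = 0"
    by (auto simp: orthogonal_comp_def orthogonal_def)
  then show False
    unfolding L0_mult_cvec by (simp add: cvec_def inner_vec_def sum_10)
qed

theorem mainTheorem4:
  shows "(\<forall>t s. spectrum (L t s) = {sqrt 3, 1 / sqrt 3, 0, - (1 / sqrt 3), - sqrt 3} \<and>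
           (\<forall>c \<in> spectrum (L t s). eigen_multiplicity (L t s) c = 2)) \<and>
    (\<forall>s. dim (Es s) = 4) \<and>
    (E = span {axis 3 1, axis 4 1, axis 5 1, axis 6 1, axis 7 1, axis 8 1} \<and> dim E > 4) \<and>
    (\<not> (\<forall>t s. (*v) (L t s) ` E \<subseteq> orthogonal_comp E) \<and> \<not> (*v) L0 ` E \<subseteq> orthogonal_comp E)"
proof -
  have "L 0 0 = L0"
    by (simp add: L_def)
  then have "\<not> (\<forall>t s. (*v) (L t s) ` E \<subseteq> orthogonal_comp E)"
    using L0_image_E by metis
  then show ?thesis
    using spectrum_L dim_Es E_eq_span_axis dim_E L0_image_E by simp
qed

end
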